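(* Let $q\in(0,1)$, let $I$ be a real interval containing $0$, let $a,b\in I$ with $a<b$, and let $\alpha,\beta\in\mathbb R$. Let $L(t,u,v)$ be a real function on $I\times\mathbb R^2$. Consider the problem of extremizing (minimizing or maximizing) $$\mathcal L[y]=\int_a^bL\left(t,y(qt),\tilde D_q[y](t)\right)\tilde d_qt$$ over all $y\in\mathcal Y^1([a,b]_q,\mathbb R)$ with $y(a)=\alpha$ and $y(b)=\beta$ (such $y$ are called admissible). Assume: (i) $(u,v)\mapsto L(t,u,v)$ is a $C^1(\mathbb R^2,\mathbb R)$ function for every $t\in[a,b]$; (ii) $t\mapsto L(t,y(qt),\tilde D_q[y](t))$ is continuous at $0$ for every admissible $y$; (iii) for every admissible $y$ and $i=0,1$, the function $t\mapsto\partial_{i+2}L(t,y(qt),\tilde D_q[y](t))$ belongs to $\mathcal Y^1([a,b]_q,\mathbb R)$; (iv) for every admissible $y$ and every admissible variation $\eta$, putting $g(t,\epsilon)=L(t,y(qt)+\epsilon\eta(qt),\tilde D_q[y](t)+\epsilon\tilde D_q[\eta](t))$, the function $g(t,\cdot)$ is differentiable at $0$ uniformly in $[a,b]_q$; the integrals $\int_0^ag(t,\epsilon)\,\tilde d_qt$ and $\int_0^bg(t,\epsilon)\,\tilde d_qt$ exist for all $\epsilon$ near $0$; and the integrals $\int_0^a\partial_2g(t,0)\,\tilde d_qt$ and $\int_0^b\partial_2g(t,0)\,\tilde d_qt$ exist. If $y_*\in\mathcal Y^1([a,b]_q,\mathbb R)$ is a local extremizer (local minimizer or local maximizer) of this problem,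 then $y=y_*$ satisfies the $q$-symmetric Euler–Lagrange equation $$\partial_2L\left(t,y(qt),\tilde D_q[y](t)\right)=\tilde D_q\left[\tau\mapsto\partial_3L\left(q\tau,y(q^2\tau),\tilde D_q[y](q\tau)\right)\right](t)$$ for all $t\in[a,b]_q$.
   Context: $q$-symmetric derivative: for $f:I\to\mathbb R$ and $t\in qI\setminus\{0\}$, $\tilde D_q[f](t)=\frac{f(qt)-f(q^{-1}t)}{(q-q^{-1})t}$, and $\tilde D_q[f](0)=f'(0)$ provided $f$ is differentiable at $0$. $\partial_jL$ is the partial derivative of $L$ with respect to its $j$th argument. Integral: $\int_a^bf\,\tilde d_qt=\int_0^bf\,\tilde d_qt-\int_0^af\,\tilde d_qt$, where $\int_0^xf(t)\,\tilde d_qt=(1-q^2)x\sum_{n=0}^{\infty}q^{2n}f(q^{2n+1}x)$; it exists when the series converge. Set: $[a,b]_q=\{q^{2n+1}a:n\in\mathbb N_0\}\cup\{q^{2n+1}b:n\in\mathbb N_0\}\cup\{0\}$. Spaces: $\mathcal Y^0([a,b]_q,\mathbb R)$ is the set of $y:I\to\mathbb R$ bounded on $[a,b]_q$ and continuous at $0$; $\mathcal Y^1([a,b]_q,\mathbb R)$ is the set of $y\in\mathcal Y^0$ such that $\tilde D_q[y]$ is bounded on $[a,b]_q$ and continuous at $0$, with norm $\|y\|_1=\sup_{t\in[a,b]_q}|y(t)|+\sup_{t\in[a,b]_q}|\tilde D_q[y](t)|$. An admissible variation is $\eta\in\mathcal Y^1([a,b]_q,\mathbb R)$ with $\eta(a)=\eta(b)=0$.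 An admissible $y_*$ is a local minimizer (resp. maximizer) if there is $\delta>0$ with $\mathcal L[y_*]\le\mathcal L[y]$ (resp. $\ge$) for all admissible $y$ with $\|y_*-y\|_1<\delta$. $g(t,\cdot)$ is differentiable at $\theta_0$ uniformly in a set $S$ if for every $\varepsilon>0$ there is $\delta>0$ such that $0<|\theta-\theta_0|<\delta$ implies $\left|\frac{g(t,\theta)-g(t,\theta_0)}{\theta-\theta_0}-\partial_2g(t,\theta_0)\right|<\varepsilon$ for all $t\in S$, where $\partial_2g=\partial g/\partial\theta$.
   Formalization: The formal theorem also assumes a ≠ q^{2k}b and b ≠ q^{2k}a for all k ≥ 0, and requires (i) for t in [a,b]_q as well as [a,b]; both are automatic if a ≤ 0 ≤ b, and without them the claim fails for a, b of the same sign. *)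

theory Defs
  imports "HOL-Analysis.Analysis"
begin

text \<open>
  A function on the interval I is represented by a total function on the reals; its values outside
  I are irrelevant. Limits, continuity and derivatives at 0 are therefore taken within I, which
  also covers the case where 0 is an endpoint of I.
\<close>

text \<open>
  The q-symmetric derivative of f on I has domain q I. At 0 it is the ordinary derivative, and
  meaningful only if f is differentiable at 0 within I; the space Y1 below demands this explicitly.
\<close>

definition qsym_deriv :: "real \<Rightarrow> real set \<Rightarrow> (real \<Rightarrow> real) \<Rightarrow> real \<Rightarrow> real" where
  "qsym_deriv q I f t =
     (if t = 0 then vector_derivative f (at 0 within I)
      else (f (q * t) - f (inverse q * t)) / ((q - inverse q) * t))"

definition qsym_integrable0 :: "real \<Rightarrow> (real \<Rightarrow> real) \<Rightarrow> real \<Rightarrow> bool" where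
  "qsym_integrable0 q f x \<longleftrightarrow> summable (\<lambda>n. q ^ (2 * n) * f (q ^ (2 * n + 1) * x))"

definition qsym_integral0 :: "real \<Rightarrow> (real \<Rightarrow> real) \<Rightarrow> real \<Rightarrow> real" where
  "qsym_integral0 q f x = (1 - q\<^sup>2) * x * (\<Sum>n. q ^ (2 * n) * f (q ^ (2 * n + 1) * x))"

definition qsym_integral :: "real \<Rightarrow> real \<Rightarrow> real \<Rightarrow> (real \<Rightarrow> real) \<Rightarrow> real" where
  "qsym_integral q a b f = qsym_integral0 q f b - qsym_integral0 q f a"

definition qset :: "real \<Rightarrow> real \<Rightarrow> real \<Rightarrow> real set" where
  "qset q a b = range (\<lambda>n::nat. q ^ (2 * n + 1) * a) \<union> range (\<lambda>n::nat. q ^ (2 * n + 1) * b) \<union> {0}"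

definition Y0 :: "real \<Rightarrow> real set \<Rightarrow> real \<Rightarrow> real \<Rightarrow> (real \<Rightarrow> real) set" where
  "Y0 q I a b = {y. bounded (y ` qset q a b) \<and> continuous (at 0 within I) y}"

definition Y1 :: "real \<Rightarrow> real set \<Rightarrow> real \<Rightarrow> real \<Rightarrow> (real \<Rightarrow> real) set" where
  "Y1 q I a b = {y \<in> Y0 q I a b.
     y differentiable (at 0 within I) \<and>
     bounded (qsym_deriv q I y ` qset q a b) \<and>
     continuous (at 0 within (*) q ` I) (qsym_deriv q I y)}"

definition norm1 :: "real \<Rightarrow> real set \<Rightarrow> real \<Rightarrow> real \<Rightarrow> (real \<Rightarrow> real) \<Rightarrow> real" where
  "norm1 q I a b y =
     (SUP t\<in>qset q a b. \<bar>y t\<bar>) + (SUP t\<in>qset q a b. \<bar>qsym_deriv q I y t\<bar>)"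

definition admissible ::
    "real \<Rightarrow> real set \<Rightarrow> real \<Rightarrow> real \<Rightarrow> real \<Rightarrow> real \<Rightarrow> (real \<Rightarrow> real) set" where
  "admissible q I a b \<alpha> \<beta> = {y \<in> Y1 q I a b. y a = \<alpha> \<and> y b = \<beta>}"

definition admissible_variation ::
    "real \<Rightarrow> real set \<Rightarrow> real \<Rightarrow> real \<Rightarrow> (real \<Rightarrow> real) set" where
  "admissible_variation q I a b = {\<eta> \<in> Y1 q I a b. \<eta> a = 0 \<and> \<eta> b = 0}"

definition qsym_functional ::
    "real \<Rightarrow> real set \<Rightarrow> real \<Rightarrow> real \<Rightarrow> (real \<Rightarrow> real \<Rightarrow> real \<Rightarrow> real) \<Rightarrow> (real \<Rightarrow> real) \<Rightarrow> real" where
  "qsym_functional q I a b L y =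
     qsym_integral q a b (\<lambda>t. L t (y (q * t)) (qsym_deriv q I y t))"

definition local_minimizer ::
    "real \<Rightarrow> real set \<Rightarrow> real \<Rightarrow> real \<Rightarrow> real \<Rightarrow> real \<Rightarrow>
     (real \<Rightarrow> real \<Rightarrow> real \<Rightarrow> real) \<Rightarrow> (real \<Rightarrow> real) \<Rightarrow> bool" where
  "local_minimizer q I a b \<alpha> \<beta> L ys \<longleftrightarrow>
     ys \<in> admissible q I a b \<alpha> \<beta> \<and>
     (\<exists>\<delta>>0. \<forall>y\<in>admissible q I a b \<alpha> \<beta>. norm1 q I a b (\<lambda>t. ys t - y t) < \<delta> \<longrightarrow>
        qsym_functional q I a b L ys \<le> qsym_functional q I a b L y)"

definition local_maximizer ::
    "real \<Rightarrow> real set \<Rightarrow> real \<Rightarrow> real \<Rightarrow> real \<Rightarrow> real \<Rightarrow>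
     (real \<Rightarrow> real \<Rightarrow> real \<Rightarrow> real) \<Rightarrow> (real \<Rightarrow> real) \<Rightarrow> bool" where
  "local_maximizer q I a b \<alpha> \<beta> L ys \<longleftrightarrow>
     ys \<in> admissible q I a b \<alpha> \<beta> \<and>
     (\<exists>\<delta>>0. \<forall>y\<in>admissible q I a b \<alpha> \<beta>. norm1 q I a b (\<lambda>t. ys t - y t) < \<delta> \<longrightarrow>
        qsym_functional q I a b L ys \<ge> qsym_functional q I a b L y)"

definition partial2 :: "(real \<Rightarrow> real \<Rightarrow> real \<Rightarrow> real) \<Rightarrow> real \<Rightarrow> real \<Rightarrow> real \<Rightarrow> real" where
  "partial2 L t u v = deriv (\<lambda>x. L t x v) u"

definition partial3 :: "(real \<Rightarrow> real \<Rightarrow> real \<Rightarrow> real) \<Rightarrow> real \<Rightarrow> real \<Rightarrow> real \<Rightarrow> real" where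
  "partial3 L t u v = deriv (\<lambda>x. L t u x) v"

definition C1_map :: "('a::real_normed_vector \<Rightarrow> 'b::real_normed_vector) \<Rightarrow> bool" where
  "C1_map f \<longleftrightarrow>
     (\<exists>f' :: 'a \<Rightarrow> 'a \<Rightarrow>\<^sub>L 'b. (\<forall>x. (f has_derivative blinfun_apply (f' x)) (at x)) \<and>
        continuous_on UNIV f')"

text \<open>
  Existence of the derivative of g t at the point is not a separate clause: the estimate itself
  says that the difference quotients converge.
\<close>

definition uniformly_differentiable_at ::
    "(real \<Rightarrow> real \<Rightarrow> real) \<Rightarrow> real \<Rightarrow> real set \<Rightarrow> bool" where
  "uniformly_differentiable_at g \<theta>0 S \<longleftrightarrow>
     (\<forall>\<epsilon>>0. \<exists>\<delta>>0. \<forall>\<theta>. 0 < \<bar>\<theta> - \<theta>0\<bar> \<and> \<bar>\<theta> - \<theta>0\<bar> < \<delta> \<longrightarrow>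
        (\<forall>t\<in>S. \<bar>(g t \<theta> - g t \<theta>0) / (\<theta> - \<theta>0) - deriv (g t) \<theta>0\<bar> < \<epsilon>))"

definition perturbed ::
    "real \<Rightarrow> real set \<Rightarrow> (real \<Rightarrow> real \<Rightarrow> real \<Rightarrow> real) \<Rightarrow> (real \<Rightarrow> real) \<Rightarrow> (real \<Rightarrow> real) \<Rightarrow>
     real \<Rightarrow> real \<Rightarrow> real" where
  "perturbed q I L y \<eta> t \<epsilon> =
     L t (y (q * t) + \<epsilon> * \<eta> (q * t)) (qsym_deriv q I y t + \<epsilon> * qsym_deriv q I \<eta> t)"

text \<open>
  For a and b of the same sign the lattice leaves the interval from a to b, and the lattices
  generated by a and by b may overlap. In the latter case the integral from a to b reduces to a
  finite sum, which carries no information about y between 0 and the nearer endpoint, and the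
  Euler-Lagrange equation fails there; non-resonance excludes exactly this case. The two lemmas
  show that neither phenomenon occurs if 0 lies between a and b.
\<close>

definition nonresonant :: "real \<Rightarrow> real \<Rightarrow> real \<Rightarrow> bool" where
  "nonresonant q a b \<longleftrightarrow> (\<forall>k::nat. a \<noteq> q ^ (2 * k) * b \<and> b \<noteq> q ^ (2 * k) * a)"

lemma nonresonant_if_zero_between:
  assumes "0 < q" "a < b" "a \<le> 0" "0 \<le> b"
  shows "nonresonant q a b"
  unfolding nonresonant_def
proof (intro allI conjI)
  fix k :: nat
  define p where "p = q ^ (2 * k)"
  have p: "p > 0" using assms(1) by (simp add: p_def)
  have "0 \<le> p * b" "p * a \<le> 0"
    using p assms(3,4) mult_nonneg_nonpos[of p a] mult_nonneg_nonneg[of p b] by simp_all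
  moreover have "0 < p * b \<or> a < 0" "p * a < 0 \<or> 0 < b"
    using p assms(2-4) mult_pos_pos[of p b] mult_pos_neg[of p a] by linarith+
  ultimately show "a \<noteq> q ^ (2 * k) * b" "b \<noteq> q ^ (2 * k) * a"
    unfolding p_def[symmetric] using assms(3,4) by linarith+
qed

lemma qset_subset_if_zero_between:
  assumes "0 < q" "q < 1" "a \<le> 0" "0 \<le> b"
  shows "qset q a b \<subseteq> {a..b}"
proof -
  have *: "a \<le> p * a \<and> p * a \<le> 0 \<and> 0 \<le> p * b \<and> p * b \<le> b" if "0 \<le> p" "p \<le> 1" for p :: real
    using that assms(3,4) mult_right_mono_neg[of p 1 a] mult_right_mono[of p 1 b]
      mult_nonneg_nonpos[of p a] mult_nonneg_nonneg[of p b]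
    by simp
  have "0 \<le> q ^ n" "q ^ n \<le> 1" for n :: nat
    using assms(1,2) by (simp_all add: power_le_one)
  then have "a \<le> q ^ n * a \<and> q ^ n * a \<le> b" "a \<le> q ^ n * b \<and> q ^ n * b \<le> b" for n :: nat
    using *[of "q ^ n"] assms(3,4) by (meson order_trans)+
  then show ?thesis
    unfolding qset_def using assms(3,4) by (auto simp del: power_Suc)
qed

end

theory Submission
  imports Defs
begin

text \<open>
  Perturb the extremizer by the indicator function of the single lattice point
  \<open>q ^ (2 * n + 2) * c\<close>, where \<open>c\<close> is a nonzero endpoint. It vanishes near 0, so it lies
  in the space Y1, and nonresonance makes it an admissible variation that does not touch the
  lattice of the other endpoint. Only the terms with indices \<open>n\<close> and \<open>n + 1\<close> of the series
  of the endpoint \<open>c\<close> change, hence the functional is differentiable along the perturbation,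
  and the vanishing of this derivative is the Euler-Lagrange equation at
  \<open>q ^ (2 * n + 1) * c\<close>. The equation at 0 follows by letting \<open>n\<close> tend to infinity.
\<close>

section \<open>Linearity of the q-symmetric derivative and of the space \<open>Y1\<close>\<close>

lemma power_eq_iff_exponent_eq:
  fixes q :: real
  assumes "0 < q" "q < 1"
  shows "q ^ m = q ^ n \<longleftrightarrow> m = n"
  using assms power_strict_decreasing[of m n q] power_strict_decreasing[of n m q]
  by (metis less_irrefl linorder_neqE_nat)

lemma vector_derivative_within_linear:
  fixes f g :: "real \<Rightarrow> real"
  assumes "at x within I \<noteq> bot" "f differentiable (at x within I)" "g differentiable (at x within I)"
  shows "vector_derivative (\<lambda>t. f t + c * g t) (at x within I) =
    vector_derivative f (at x within I) + c * vector_derivative g (at x within I)"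
proof -
  have "(f has_vector_derivative vector_derivative f (at x within I)) (at x within I)"
    "(g has_vector_derivative vector_derivative g (at x within I)) (at x within I)"
    using assms(2,3) by (auto simp: vector_derivative_works)
  then have "((\<lambda>t. f t + c * g t) has_vector_derivative
      vector_derivative f (at x within I) + c * vector_derivative g (at x within I)) (at x within I)"
    by (intro has_vector_derivative_add has_vector_derivative_mult_right)
  then show ?thesis
    using assms(1) by (rule vector_derivative_within[rotated])
qed

text \<open>Away from 0 this is algebra with difference quotients. The assumptions serve the point
  0, where the value is the classical derivative within \<open>I\<close>, which is unique because 0
  is a limit point of \<open>I\<close>.\<close>

lemma qsym_deriv_linear:
  assumes "at 0 within I \<noteq> bot" "f differentiable (at 0 within I)" "g differentiable (at 0 within I)"
  shows "qsym_deriv q I (\<lambda>t. f t + c * g t) = (\<lambda>t. qsym_deriv q I f t + c * qsym_deriv q I g t)"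
proof
  fix t
  show "qsym_deriv q I (\<lambda>t. f t + c * g t) t = qsym_deriv q I f t + c * qsym_deriv q I g t"
  proof (cases "t = 0")
    case True
    then show ?thesis
      using vector_derivative_within_linear[OF assms] by (simp add: qsym_deriv_def)
  next
    case False
    have "(f (q * t) + c * g (q * t)) - (f (inverse q * t) + c * g (inverse q * t)) =
        (f (q * t) - f (inverse q * t)) + c * (g (q * t) - g (inverse q * t))"
      by (simp add: algebra_simps)
    then show ?thesis
      using False by (simp only: qsym_deriv_def if_False add_divide_distrib times_divide_eq_right)
  qed
qed

lemma bounded_linear_combination_image:
  fixes f g :: "'a \<Rightarrow> real"
  assumes "bounded (f ` S)" "bounded (g ` S)"
  shows "bounded ((\<lambda>t. f t + c * g t) ` S)"
  using bounded_plus_comp[OF assms(1) bounded_scaleR_comp[OF assms(2), of c]] by simp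

lemma Y1_linear:
  assumes "at 0 within I \<noteq> bot" "f \<in> Y1 q I a b" "g \<in> Y1 q I a b"
  shows "(\<lambda>t. f t + c * g t) \<in> Y1 q I a b"
proof -
  have D: "f differentiable (at 0 within I)" "g differentiable (at 0 within I)"
    using assms by (auto simp: Y1_def)
  show ?thesis
    using assms(2,3) unfolding Y1_def Y0_def
    by (auto simp: qsym_deriv_linear[OF assms(1) D]
        intro!: bounded_linear_combination_image continuous_intros)
qed

section \<open>Indicator functions of single points\<close>

lemma qsym_deriv_single_point:
  assumes "p \<noteq> 0" "at 0 within I \<noteq> bot"
  shows "(\<lambda>t. if t = p then 1 else (0::real)) differentiable (at 0 within I)"
    and "qsym_deriv q I (\<lambda>t. if t = p then 1 else 0) 0 = 0"
proof -
  let ?e = "\<lambda>t. if t = p then 1 else (0::real)"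
  have "(?e has_vector_derivative 0) (at 0)"
    by (rule has_vector_derivative_transform_within_open[of "\<lambda>_. 0" _ _ "- {p}"]) (use assms(1) in auto)
  then have "(?e has_vector_derivative 0) (at 0 within I)"
    by (rule has_vector_derivative_at_within)
  then show "?e differentiable (at 0 within I)" "qsym_deriv q I ?e 0 = 0"
    using assms(2) by (auto simp: qsym_deriv_def vector_derivative_within differentiableI_vector)
qed

text \<open>The indicator of \<open>p\<close> has a q-symmetric derivative supported on the two
  points \<open>p / q\<close> and \<open>q * p\<close>. Hence both functions take finitely many
  values, which gives boundedness, and both vanish near 0, which gives continuity there.\<close>

lemma single_point_in_Y1:
  assumes "0 < q" "p \<noteq> 0" "at 0 within I \<noteq> bot"
  shows "(\<lambda>t. if t = p then 1 else 0) \<in> Y1 q I a b"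
proof -
  let ?e = "\<lambda>t. if t = p then 1 else (0::real)"
  let ?D = "qsym_deriv q I ?e"
  have ev: "eventually (\<lambda>t. t \<noteq> r) (at 0 within S)" if "r \<noteq> 0" for r :: real and S
    using eventually_nhds_in_open[OF open_Compl[OF closed_singleton[of r]], of 0] that
    by (auto elim!: eventually_mono simp: eventually_at_filter)
  have D0: "?D t = 0" if "t \<noteq> p / q" "t \<noteq> q * p" for t
    using that assms qsym_deriv_single_point(2)[OF assms(2,3), of q]
    by (cases "t = 0") (auto simp: qsym_deriv_def field_simps)
  have "?D t \<in> {0, ?D (p / q), ?D (q * p)}" for t
    using D0[of t] by (cases "t = p / q"; cases "t = q * p") auto
  then have "?D ` qset q a b \<subseteq> {0, ?D (p / q), ?D (q * p)}"
    by blast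
  then have "bounded (?D ` qset q a b)"
    by (rule finite_imp_bounded[OF finite_subset]) simp
  moreover have "bounded (?e ` qset q a b)"
    by (rule finite_imp_bounded, rule finite_subset[of _ "{0, 1}"]) auto
  moreover have "continuous (at 0 within (*) q ` I) ?D"
  proof -
    have "eventually (\<lambda>t. ?D t = 0) (at 0 within (*) q ` I)"
      using ev[of "p / q" "(*) q ` I"] ev[of "q * p" "(*) q ` I"] assms(1,2)
      by (auto elim: eventually_elim2 intro: D0)
    then have "(?D \<longlongrightarrow> 0) (at 0 within (*) q ` I)"
      by (rule tendsto_eventually)
    then show ?thesis
      using qsym_deriv_single_point(2)[OF assms(2,3)] by (simp add: continuous_within)
  qed
  moreover have "?e differentiable (at 0 within I)"
    using qsym_deriv_single_point(1)[OF assms(2,3)] .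
  ultimately show ?thesis
    by (auto simp: Y1_def Y0_def intro: differentiable_imp_continuous_within)
qed

section \<open>Vanishing of the first variation\<close>

lemma norm1_le:
  assumes "\<And>t. t \<in> qset q a b \<Longrightarrow> \<bar>y t\<bar> \<le> A" "\<And>t. t \<in> qset q a b \<Longrightarrow> \<bar>qsym_deriv q I y t\<bar> \<le> B"
  shows "norm1 q I a b y \<le> A + B"
proof -
  have "qset q a b \<noteq> {}"
    by (auto simp: qset_def)
  then show ?thesis
    unfolding norm1_def using assms by (intro add_mono cSUP_least)
qed

text \<open>The boundary values survive because \<open>\<eta>\<close> vanishes at both endpoints.
  The distance is at most \<open>\<bar>\<epsilon>\<bar> * (A + B)\<close>, where \<open>A\<close>
  and \<open>B\<close> bound \<open>\<eta>\<close> and its q-symmetric derivative on the lattice,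
  and this tends to 0.\<close>

lemma eventually_admissible_near:
  assumes "at 0 within I \<noteq> bot" "ys \<in> admissible q I a b \<alpha> \<beta>"
    and "\<eta> \<in> admissible_variation q I a b" "0 < \<delta>"
  shows "eventually (\<lambda>\<epsilon>. (\<lambda>t. ys t + \<epsilon> * \<eta> t) \<in> admissible q I a b \<alpha> \<beta> \<and>
    norm1 q I a b (\<lambda>t. ys t - (ys t + \<epsilon> * \<eta> t)) < \<delta>) (nhds 0)"
proof -
  have Y: "ys \<in> Y1 q I a b" "\<eta> \<in> Y1 q I a b"
    using assms by (auto simp: admissible_def admissible_variation_def)
  then have D: "\<eta> differentiable (at 0 within I)"
    by (auto simp: Y1_def)
  obtain A where A: "\<And>t. t \<in> qset q a b \<Longrightarrow> \<bar>\<eta> t\<bar> \<le> A"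
    using Y(2) by (auto simp: Y1_def Y0_def bounded_iff)
  obtain B where B: "\<And>t. t \<in> qset q a b \<Longrightarrow> \<bar>qsym_deriv q I \<eta> t\<bar> \<le> B"
    using Y(2) by (auto simp: Y1_def Y0_def bounded_iff)
  have bound: "norm1 q I a b (\<lambda>t. ys t - (ys t + \<epsilon> * \<eta> t)) \<le> \<bar>\<epsilon>\<bar> * A + \<bar>\<epsilon>\<bar> * B" for \<epsilon>
  proof (rule norm1_le)
    \<comment> \<open>The difference equals \<open>0 + (- \<epsilon>) * \<eta> t\<close>, so
      linearity is applied with the zero function as first summand.\<close>
    have "qsym_deriv q I (\<lambda>_. 0) t = 0" for t
      by (simp add: qsym_deriv_def vector_derivative_within[OF assms(1)])
    then have "qsym_deriv q I (\<lambda>t. ys t - (ys t + \<epsilon> * \<eta> t)) t = - \<epsilon> * qsym_deriv q I \<eta> t" for t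
      using qsym_deriv_linear[OF assms(1) _ D, of "\<lambda>_. 0" q "- \<epsilon>"] by simp
    then show "\<bar>qsym_deriv q I (\<lambda>t. ys t - (ys t + \<epsilon> * \<eta> t)) t\<bar> \<le> \<bar>\<epsilon>\<bar> * B"
      if "t \<in> qset q a b" for t
      using B[OF that] by (simp add: abs_mult mult_left_mono)
  qed (simp add: A abs_mult mult_left_mono)
  have "((\<lambda>\<epsilon>. \<bar>\<epsilon>\<bar> * A + \<bar>\<epsilon>\<bar> * B) \<longlongrightarrow> \<bar>0\<bar> * A + \<bar>0\<bar> * B) (nhds 0)"
    by (intro tendsto_intros filterlim_ident)
  then have "eventually (\<lambda>\<epsilon>. \<bar>\<epsilon>\<bar> * A + \<bar>\<epsilon>\<bar> * B < \<delta>) (nhds 0)"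
    using assms(4) by (auto intro: order_tendstoD)
  then show ?thesis
  proof eventually_elim
    case (elim \<epsilon>)
    have "(\<lambda>t. ys t + \<epsilon> * \<eta> t) \<in> admissible q I a b \<alpha> \<beta>"
      using Y1_linear[OF assms(1) Y, of \<epsilon>] assms(2,3)
      by (auto simp: admissible_def admissible_variation_def)
    then show ?case
      using bound[of \<epsilon>] elim by simp
  qed
qed

lemma qsym_functional_perturbed:
  assumes "at 0 within I \<noteq> bot" "ys \<in> Y1 q I a b" "\<eta> \<in> Y1 q I a b"
  shows "qsym_functional q I a b L (\<lambda>t. ys t + \<epsilon> * \<eta> t) =
    qsym_integral q a b (\<lambda>t. perturbed q I L ys \<eta> t \<epsilon>)"
  using assms by (simp add: qsym_functional_def perturbed_def qsym_deriv_linear Y1_def)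

text \<open>Fermat's rule: for small \<open>\<epsilon>\<close> the perturbed functions are
  admissible competitors close to \<open>ys\<close>, so the functional restricted to this line has a
  local extremum at \<open>\<epsilon> = 0\<close>.\<close>

lemma first_variation_eq_0:
  assumes "at 0 within I \<noteq> bot" "\<eta> \<in> admissible_variation q I a b"
    and ext: "local_minimizer q I a b \<alpha> \<beta> L ys \<or> local_maximizer q I a b \<alpha> \<beta> L ys"
    and deriv: "((\<lambda>\<epsilon>. qsym_integral q a b (\<lambda>t. perturbed q I L ys \<eta> t \<epsilon>)) has_field_derivative l) (at 0)"
  shows "l = 0"
proof -
  define \<phi> where "\<phi> \<epsilon> = qsym_functional q I a b L (\<lambda>t. ys t + \<epsilon> * \<eta> t)" for \<epsilon>
  have ys: "ys \<in> admissible q I a b \<alpha> \<beta>"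
    using ext by (auto simp: local_minimizer_def local_maximizer_def)
  have \<phi>: "\<phi> = (\<lambda>\<epsilon>. qsym_integral q a b (\<lambda>t. perturbed q I L ys \<eta> t \<epsilon>))"
    using assms(1,2) ys
    by (auto simp: \<phi>_def fun_eq_iff qsym_functional_perturbed admissible_def admissible_variation_def)
  have D: "(\<phi> has_field_derivative l) (at 0)"
    using deriv by (simp add: \<phi>)
  have \<phi>0: "\<phi> 0 = qsym_functional q I a b L ys"
    by (simp add: \<phi>_def)
  note near = eventually_admissible_near[OF assms(1) ys assms(2)]
  show ?thesis
    using ext
  proof
    assume "local_minimizer q I a b \<alpha> \<beta> L ys"
    then obtain \<delta> where \<delta>: "0 < \<delta>" "\<And>y. y \<in> admissible q I a b \<alpha> \<beta> \<Longrightarrow>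
        norm1 q I a b (\<lambda>t. ys t - y t) < \<delta> \<Longrightarrow> \<phi> 0 \<le> qsym_functional q I a b L y"
      by (auto simp: local_minimizer_def \<phi>0)
    have "eventually (\<lambda>\<epsilon>. \<phi> 0 \<le> \<phi> \<epsilon>) (nhds 0)"
      using near[OF \<delta>(1)] by eventually_elim (use \<delta>(2) in \<open>unfold \<phi>_def, blast\<close>)
    then obtain d where "0 < d" "\<forall>\<epsilon>. \<bar>0 - \<epsilon>\<bar> < d \<longrightarrow> \<phi> 0 \<le> \<phi> \<epsilon>"
      by (auto simp: eventually_nhds_metric dist_real_def)
    then show ?thesis
      by (rule DERIV_local_min[OF D])
  next
    assume "local_maximizer q I a b \<alpha> \<beta> L ys"
    then obtain \<delta> where \<delta>: "0 < \<delta>" "\<And>y. y \<in> admissible q I a b \<alpha> \<beta> \<Longrightarrow>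
        norm1 q I a b (\<lambda>t. ys t - y t) < \<delta> \<Longrightarrow> \<phi> 0 \<ge> qsym_functional q I a b L y"
      by (auto simp: local_maximizer_def \<phi>0)
    have "eventually (\<lambda>\<epsilon>. \<phi> 0 \<ge> \<phi> \<epsilon>) (nhds 0)"
      using near[OF \<delta>(1)] by eventually_elim (use \<delta>(2) in \<open>unfold \<phi>_def, blast\<close>)
    then obtain d where "0 < d" "\<forall>\<epsilon>. \<bar>0 - \<epsilon>\<bar> < d \<longrightarrow> \<phi> \<epsilon> \<le> \<phi> 0"
      by (auto simp: eventually_nhds_metric dist_real_def)
    then show ?thesis
      by (rule DERIV_local_max[OF D])
  qed
qed

section \<open>Derivative of the integrand and of the series\<close>

lemma C1_map_has_field_derivative_line:
  assumes "C1_map (\<lambda>(u, v). L t u v)"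
  shows "((\<lambda>\<epsilon>. L t (u + \<epsilon> * h) (v + \<epsilon> * k)) has_field_derivative
    partial2 L t u v * h + partial3 L t u v * k) (at 0)"
proof -
  let ?f = "\<lambda>(u, v). L t u v"
  obtain F where F: "(?f has_derivative blinfun_apply F) (at (u, v))"
    using assms by (auto simp: C1_map_def)
  \<comment> \<open>The line passes through \<open>(u, v)\<close> at \<open>x = s\<close>. The
    choices \<open>s = u\<close> with direction \<open>(1, 0)\<close> and \<open>s = v\<close> with
    direction \<open>(0, 1)\<close> turn it into the one-variable functions that define the partial
    derivatives; \<open>s = 0\<close> gives the claim.\<close>
  have line: "((\<lambda>x. L t (u + (x - s) * h) (v + (x - s) * k)) has_field_derivative F (h, k)) (at s)"
    for h k s
  proof -
    have "(?f has_derivative blinfun_apply F) (at (u + (s - s) * h, v + (s - s) * k))"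
      using F by simp
    moreover have "((\<lambda>x. (u + (x - s) * h, v + (x - s) * k)) has_derivative (\<lambda>x. (x * h, x * k))) (at s)"
      by (auto intro!: derivative_eq_intros)
    ultimately have "((\<lambda>x. ?f (u + (x - s) * h, v + (x - s) * k)) has_derivative (\<lambda>x. F (x * h, x * k))) (at s)"
      using has_derivative_compose by blast
    moreover have "F (x * h, x * k) = F (h, k) * x" for x
      using blinfun.scaleR_right[of F x "(h, k)"] by simp
    ultimately show ?thesis
      by (simp add: has_field_derivative_def)
  qed
  have "partial2 L t u v = F (1, 0)" "partial3 L t u v = F (0, 1)"
    using line[of u 1 0] line[of v 0 1] by (auto simp: partial2_def partial3_def intro: DERIV_imp_deriv)
  moreover have "F (h, k) = F (1, 0) * h + F (0, 1) * k"
    using blinfun.add_right[of F "h *\<^sub>R (1, 0)" "k *\<^sub>R (0, 1)"]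
      blinfun.scaleR_right[of F h "(1, 0)"] blinfun.scaleR_right[of F k "(0, 1)"] by simp
  ultimately show ?thesis
    using line[of 0 h k] by simp
qed

text \<open>The two series differ by one with finitely many nonzero terms, so convergence for
  \<open>f\<close> carries over to \<open>g\<close>. Thus the dependence of the integral on a
  perturbation parameter is confined to a finite sum, which can be differentiated term by
  term.\<close>

lemma qsym_integral0_finite_change:
  assumes "qsym_integrable0 q f c" "finite A"
    and "\<And>k. k \<notin> A \<Longrightarrow> g (q ^ (2 * k + 1) * c) = f (q ^ (2 * k + 1) * c)"
  shows "qsym_integral0 q g c = qsym_integral0 q f c + (1 - q\<^sup>2) * c *
    (\<Sum>k\<in>A. q ^ (2 * k) * (g (q ^ (2 * k + 1) * c) - f (q ^ (2 * k + 1) * c)))"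
proof -
  let ?t = "\<lambda>k. q ^ (2 * k + 1) * c"
  have "(\<lambda>k. q ^ (2 * k) * (g (?t k) - f (?t k))) sums (\<Sum>k\<in>A. q ^ (2 * k) * (g (?t k) - f (?t k)))"
    by (rule sums_finite) (use assms in auto)
  moreover have "(\<lambda>k. q ^ (2 * k) * f (?t k)) sums (\<Sum>k. q ^ (2 * k) * f (?t k))"
    using assms(1) by (auto simp: qsym_integrable0_def)
  ultimately have "(\<lambda>k. q ^ (2 * k) * f (?t k) + q ^ (2 * k) * (g (?t k) - f (?t k))) sums
      ((\<Sum>k. q ^ (2 * k) * f (?t k)) + (\<Sum>k\<in>A. q ^ (2 * k) * (g (?t k) - f (?t k))))"
    by (intro sums_add)
  then have "(\<Sum>k. q ^ (2 * k) * g (?t k)) =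
      (\<Sum>k. q ^ (2 * k) * f (?t k)) + (\<Sum>k\<in>A. q ^ (2 * k) * (g (?t k) - f (?t k)))"
    by (simp add: sums_iff right_diff_distrib)
  then show ?thesis
    by (simp only: qsym_integral0_def distrib_left)
qed

theorem theorem6p3p5:
  fixes q a b \<alpha> \<beta> :: real
    and I :: "real set"
    and L :: "real \<Rightarrow> real \<Rightarrow> real \<Rightarrow> real"
    and ys :: "real \<Rightarrow> real"
  assumes q: "0 < q" "q < 1"
    and I: "is_interval I" "0 \<in> I"
    and ab: "a \<in> I" "b \<in> I" "a < b"
    and nonres: "nonresonant q a b"
    and C1: "\<forall>t\<in>{a..b} \<union> qset q a b. C1_map (\<lambda>(u, v). L t u v)"
    and cont0: "\<forall>y\<in>admissible q I a b \<alpha> \<beta>.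
        continuous (at 0 within (*) q ` I) (\<lambda>t. L t (y (q * t)) (qsym_deriv q I y t))"
    and partials: "\<forall>y\<in>admissible q I a b \<alpha> \<beta>.
        (\<lambda>t. partial2 L t (y (q * t)) (qsym_deriv q I y t)) \<in> Y1 q I a b \<and>
        (\<lambda>t. partial3 L t (y (q * t)) (qsym_deriv q I y t)) \<in> Y1 q I a b"
    and variations: "\<forall>y\<in>admissible q I a b \<alpha> \<beta>. \<forall>\<eta>\<in>admissible_variation q I a b.
        uniformly_differentiable_at (perturbed q I L y \<eta>) 0 (qset q a b) \<and>
        (\<forall>\<^sub>F \<epsilon> in nhds 0.
           qsym_integrable0 q (\<lambda>t. perturbed q I L y \<eta> t \<epsilon>) a \<and>
           qsym_integrable0 q (\<lambda>t. perturbed q I L y \<eta> t \<epsilon>) b) \<and>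
        qsym_integrable0 q (\<lambda>t. deriv (perturbed q I L y \<eta> t) 0) a \<and>
        qsym_integrable0 q (\<lambda>t. deriv (perturbed q I L y \<eta> t) 0) b"
    and extremizer: "local_minimizer q I a b \<alpha> \<beta> L ys \<or> local_maximizer q I a b \<alpha> \<beta> L ys"
  shows "\<forall>t\<in>qset q a b.
    partial2 L t (ys (q * t)) (qsym_deriv q I ys t) =
    qsym_deriv q I (\<lambda>\<tau>. partial3 L (q * \<tau>) (ys (q\<^sup>2 * \<tau>)) (qsym_deriv q I ys (q * \<tau>))) t"
proof
  \<comment> \<open>A connected set with more than one point has no isolated points, so derivatives
    at 0 within \<open>I\<close> are unique.\<close>
  have "connected I" "I \<noteq> {0}"
    using I(1) is_interval_connected ab by auto
  then have nb: "at 0 within I \<noteq> bot"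
    using connected_imp_perfect[of I 0] I(2) by (auto simp: trivial_limit_within)
  define P where "P t = partial3 L t (ys (q * t)) (qsym_deriv q I ys t)" for t
  define Q where "Q t = partial2 L t (ys (q * t)) (qsym_deriv q I ys t)" for t
  have ys: "ys \<in> admissible q I a b \<alpha> \<beta>"
    using extremizer by (auto simp: local_minimizer_def local_maximizer_def)
  have "Q \<in> Y1 q I a b" "P \<in> Y1 q I a b"
    using partials ys by (auto simp: P_def[abs_def] Q_def[abs_def])
  then have Q0: "continuous (at 0 within I) Q" and P0: "P differentiable (at 0 within I)"
    by (auto simp: Y1_def Y0_def)
  have RHS: "(\<lambda>\<tau>. partial3 L (q * \<tau>) (ys (q\<^sup>2 * \<tau>)) (qsym_deriv q I ys (q * \<tau>))) = (\<lambda>\<tau>. P (q * \<tau>))"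
    by (simp add: P_def power2_eq_square mult.assoc)

  \<comment> \<open>The equation at lattice points, cleared of denominators\<close>
  have EL: "Q (q ^ (2 * n + 1) * c) * ((1 - q\<^sup>2) * (q ^ (2 * n) * c)) =
      P (q ^ (2 * n + 1) * c) - P (q ^ (2 * n + 3) * c)"
    if cd: "c = a \<and> d = b \<or> c = b \<and> d = a" and "c \<noteq> 0" for c d n
  proof -
    \<comment> \<open>With \<open>t k\<close> as below, \<open>p\<close> is both
      \<open>q * t n\<close> and \<open>inverse q * t (Suc n)\<close>. The integrand evaluates
      \<open>\<eta>\<close> only at such neighbours of lattice points, which carry even powers of
      \<open>q\<close>.\<close>
    define p where "p = q ^ (2 * Suc n) * c"
    define \<eta> where "\<eta> = (\<lambda>t. if t = p then 1 else (0::real))"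
    define t where "t k = q ^ (2 * k + 1) * c" for k
    define f where "f \<epsilon> s = perturbed q I L ys \<eta> s \<epsilon>" for \<epsilon> s
    have p: "p \<noteq> 0"
      using q(1) \<open>c \<noteq> 0\<close> by (simp add: p_def)
    have t: "t k \<noteq> 0" "t k \<in> qset q a b" for k
      using q(1) \<open>c \<noteq> 0\<close> cd by (auto simp: t_def qset_def)
    have c_lattice: "q ^ (2 * k) * c = p \<longleftrightarrow> k = Suc n" for k
      using \<open>c \<noteq> 0\<close> power_eq_iff_exponent_eq[OF q, of "2 * k" "2 * Suc n"]
      by (simp add: p_def del: power_Suc mult_Suc_right)
    \<comment> \<open>Otherwise cancelling the smaller power of \<open>q\<close> exhibits one
      endpoint as an even power of \<open>q\<close> times the other, against nonresonance.\<close>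
    have d_lattice: "q ^ (2 * k) * d \<noteq> p" for k
    proof
      assume eq: "q ^ (2 * k) * d = p"
      show False
      proof (cases "k \<le> Suc n")
        case True
        then have "q ^ (2 * Suc n) = q ^ (2 * k) * q ^ (2 * (Suc n - k))"
          by (metis add_mult_distrib2 le_add_diff_inverse power_add)
        then have "d = q ^ (2 * (Suc n - k)) * c"
          using eq q(1) unfolding p_def by (simp only: mult.assoc) auto
        then show False
          using nonres cd unfolding nonresonant_def by blast
      next
        case False
        then have "q ^ (2 * k) = q ^ (2 * Suc n) * q ^ (2 * (k - Suc n))"
          by (metis add_mult_distrib2 le_add_diff_inverse nat_le_linear power_add)
        then have "c = q ^ (2 * (k - Suc n)) * d"
          using eq q(1) unfolding p_def by (simp only: mult.assoc) auto
        then show False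
          using nonres cd unfolding nonresonant_def by blast
      qed
    qed
    \<comment> \<open>The endpoints are the case \<open>k = 0\<close> of the even powers;
      \<open>c\<close> differs from \<open>p\<close> since the exponent of \<open>p\<close> is at
      least 2.\<close>
    have "\<eta> c = 0" "\<eta> d = 0"
      using c_lattice[of 0] d_lattice[of 0] by (simp_all add: \<eta>_def)
    then have \<eta>: "\<eta> \<in> admissible_variation q I a b"
      using single_point_in_Y1[OF q(1) p nb] cd by (auto simp: admissible_variation_def \<eta>_def)
    have step: "q * (q ^ (2 * k + 1) * x) = q ^ (2 * Suc k) * x"
      "inverse q * (q ^ (2 * k + 1) * x) = q ^ (2 * k) * x" for k x
      using q(1) by (simp_all add: field_simps)
    have \<eta>_t: "\<eta> (q * t k) = (if k = n then 1 else 0)"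
      "\<eta> (inverse q * t k) = (if k = Suc n then 1 else 0)" for k
      unfolding t_def step \<eta>_def c_lattice by simp_all
    \<comment> \<open>Up to sign, this denominator at \<open>k = n\<close> is the factor by which
      \<open>EL\<close> is multiplied out.\<close>
    have denom: "(q - inverse q) * t k = - ((1 - q\<^sup>2) * (q ^ (2 * k) * c))" for k
      using q(1) by (simp add: t_def field_simps power2_eq_square)
    have D\<eta>_t: "qsym_deriv q I \<eta> (t k) =
        ((if k = n then 1 else 0) - (if k = Suc n then 1 else 0)) / - ((1 - q\<^sup>2) * (q ^ (2 * k) * c))" for k
      using t(1)[of k] by (simp only: qsym_deriv_def \<eta>_t denom if_False)

    have f_c: "f \<epsilon> (t k) = f 0 (t k)" if "k \<notin> {n, Suc n}" for k \<epsilon>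
      using that by (simp add: f_def perturbed_def \<eta>_t D\<eta>_t)
    \<comment> \<open>For \<open>d \<noteq> 0\<close> the neighbours of the lattice points of
      \<open>d\<close> are even powers of \<open>q\<close> times \<open>d\<close>, never
      \<open>p\<close>, so no term changes. For \<open>d = 0\<close> the prefactor of the integral
      vanishes.\<close>
    have f_d: "qsym_integral0 q (f \<epsilon>) d = qsym_integral0 q (f 0) d" for \<epsilon>
    proof (cases "d = 0")
      case False
      then have "f \<epsilon> (q ^ (2 * k + 1) * d) = f 0 (q ^ (2 * k + 1) * d)" for k
        using d_lattice q(1) unfolding f_def perturbed_def qsym_deriv_def step
        by (simp add: \<eta>_def del: power_Suc mult_Suc_right)
      then show ?thesis
        by (simp only: qsym_integral0_def)
    qed (simp add: qsym_integral0_def)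
    have "\<forall>\<^sub>F \<epsilon> in nhds 0. qsym_integrable0 q (f \<epsilon>) a \<and> qsym_integrable0 q (f \<epsilon>) b"
      using variations ys \<eta> unfolding f_def by blast
    then have f_0: "qsym_integrable0 q (f 0) c"
      using eventually_nhds_x_imp_x cd by blast
    define K where "K = qsym_integral0 q (f 0) c"
    have change: "qsym_integral0 q (f \<epsilon>) c = K +
        (1 - q\<^sup>2) * c * (\<Sum>k\<in>{n, Suc n}. q ^ (2 * k) * (f \<epsilon> (t k) - f 0 (t k)))" for \<epsilon>
      using f_0 f_c unfolding t_def K_def
      by (intro qsym_integral0_finite_change[of q "f 0" c "{n, Suc n}" "f \<epsilon>"]) blast+

    let ?S = "\<Sum>k\<in>{n, Suc n}. q ^ (2 * k) * (Q (t k) * \<eta> (q * t k) + P (t k) * qsym_deriv q I \<eta> (t k))"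
    have "((\<lambda>\<epsilon>. f \<epsilon> (t k)) has_field_derivative
        Q (t k) * \<eta> (q * t k) + P (t k) * qsym_deriv q I \<eta> (t k)) (at 0)" for k
      unfolding f_def perturbed_def Q_def P_def
      using C1 t(2)[of k] by (intro C1_map_has_field_derivative_line) blast
    then have "((\<lambda>\<epsilon>. qsym_integral0 q (f \<epsilon>) c) has_field_derivative (1 - q\<^sup>2) * c * ?S) (at 0)"
      unfolding change by (auto intro!: derivative_eq_intros)
    then have D: "((\<lambda>\<epsilon>. \<sigma> * (qsym_integral0 q (f \<epsilon>) c - qsym_integral0 q (f 0) d)) has_field_derivative
        \<sigma> * ((1 - q\<^sup>2) * c * ?S)) (at 0)" for \<sigma>
      by (auto intro!: derivative_eq_intros)
    \<comment> \<open>The sign with which the part of the endpoint \<open>c\<close> enters the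
      integral from \<open>a\<close> to \<open>b\<close>.\<close>
    define \<sigma> :: real where "\<sigma> = (if c = b then 1 else - 1)"
    have "qsym_integral q a b (f \<epsilon>) = \<sigma> * (qsym_integral0 q (f \<epsilon>) c - qsym_integral0 q (f 0) d)" for \<epsilon>
      using cd f_d[of \<epsilon>] ab(3) by (auto simp: qsym_integral_def \<sigma>_def)
    then have "\<sigma> * ((1 - q\<^sup>2) * c * ?S) = 0"
      using D[of \<sigma>] unfolding f_def
      by (intro first_variation_eq_0[OF nb \<eta> extremizer]) simp
    moreover have "1 - q\<^sup>2 \<noteq> 0" "\<sigma> \<noteq> 0"
      using q power_less_one_iff[of q 2] by (auto simp: \<sigma>_def)
    \<comment> \<open>At index \<open>n\<close> both \<open>\<eta> (q * t n) = 1\<close> and a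
      negative derivative of \<open>\<eta>\<close> contribute; at \<open>Suc n\<close> only a
      positive derivative does. In each derivative term the weight of the series cancels the power
      of \<open>q\<close> in the denominator.\<close>
    moreover have "q ^ (2 * n) * (Q (t n) * \<eta> (q * t n) + P (t n) * qsym_deriv q I \<eta> (t n)) =
        q ^ (2 * n) * Q (t n) - P (t n) / ((1 - q\<^sup>2) * c)"
      using q(1) \<open>c \<noteq> 0\<close> \<open>1 - q\<^sup>2 \<noteq> 0\<close>
      unfolding \<eta>_t D\<eta>_t by (simp add: field_simps)
    moreover have "q ^ (2 * Suc n) *
        (Q (t (Suc n)) * \<eta> (q * t (Suc n)) + P (t (Suc n)) * qsym_deriv q I \<eta> (t (Suc n))) =
        P (t (Suc n)) / ((1 - q\<^sup>2) * c)"
      using q(1) \<open>c \<noteq> 0\<close> \<open>1 - q\<^sup>2 \<noteq> 0\<close>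
      unfolding \<eta>_t D\<eta>_t by (simp add: field_simps)
    ultimately have "q ^ (2 * n) * Q (t n) - P (t n) / ((1 - q\<^sup>2) * c) + P (t (Suc n)) / ((1 - q\<^sup>2) * c) = 0"
      using \<open>c \<noteq> 0\<close> by (simp del: power_Suc mult_Suc_right)
    moreover have "(x * w) * y = u - v" if "x * y - u / w + v / w = 0" "w \<noteq> 0" for x y u v w :: real
      using that by (simp add: field_simps)
    ultimately have "(q ^ (2 * n) * ((1 - q\<^sup>2) * c)) * Q (t n) = P (t n) - P (t (Suc n))"
      using \<open>c \<noteq> 0\<close> \<open>1 - q\<^sup>2 \<noteq> 0\<close> by simp
    moreover have "t (Suc n) = q ^ (2 * n + 3) * c"
      by (simp add: t_def numeral_3_eq_3)
    ultimately show ?thesis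
      unfolding t_def[of n, symmetric] by (simp only: mult_ac)
  qed

  \<comment> \<open>The equation at lattice points as a q-symmetric derivative\<close>
  have EL_lattice: "Q s = qsym_deriv q I (\<lambda>\<tau>. P (q * \<tau>)) s"
    if s: "s = q ^ (2 * n + 1) * c" and cd: "c = a \<and> d = b \<or> c = b \<and> d = a" and "c \<noteq> 0" for c d n s
  proof -
    define w where "w = (1 - q\<^sup>2) * (q ^ (2 * n) * c)"
    have "1 - q\<^sup>2 \<noteq> 0"
      using q power_less_one_iff[of q 2] by auto
    then have w: "w \<noteq> 0"
      using q(1) \<open>c \<noteq> 0\<close> by (simp add: w_def)
    have "s \<noteq> 0"
      using q(1) \<open>c \<noteq> 0\<close> by (simp add: s)
    have "q * (q * s) = q ^ (2 * n + 3) * c"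
      unfolding s by (simp add: numeral_3_eq_3 del: power_Suc) (simp add: mult_ac)
    moreover have "q * (inverse q * s) = s"
      using q(1) by simp
    moreover have "(q - inverse q) * s = - w"
      using q(1) by (simp add: s w_def field_simps power2_eq_square)
    ultimately have "qsym_deriv q I (\<lambda>\<tau>. P (q * \<tau>)) s = (P (q ^ (2 * n + 3) * c) - P s) / - w"
      using \<open>s \<noteq> 0\<close> by (simp only: qsym_deriv_def if_False)
    also have "\<dots> = - (Q s * w) / - w"
      using EL[OF cd \<open>c \<noteq> 0\<close>, of n] unfolding s[symmetric] w_def[symmetric] by simp
    also have "\<dots> = Q s"
      using w by simp
    finally show ?thesis ..
  qed

  \<comment> \<open>The equation at the point 0\<close>
  have EL_0: "Q 0 = qsym_deriv q I (\<lambda>\<tau>. P (q * \<tau>)) 0"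
  proof -
    \<comment> \<open>Since \<open>a < b\<close>, some endpoint is nonzero; its lattice supplies the
      nonzero points \<open>s n\<close> tending to 0.\<close>
    obtain c d where cd: "c = a \<and> d = b \<or> c = b \<and> d = a" and "c \<noteq> 0"
      using ab(3) by (metis less_irrefl)
    have scale: "r * x \<in> I" if "x \<in> I" "0 \<le> r" "r \<le> 1" for r x
    proof -
      have "r * x \<in> closed_segment 0 x"
        using that(2,3) by (auto simp: in_segment)
      then show ?thesis
        using I that(1) by (meson closed_segment_subset is_interval_convex subsetD)
    qed
    define D where "D = vector_derivative P (at 0 within I)"
    have D: "(P has_field_derivative D) (at 0 within I)"
      using P0 by (simp add: D_def vector_derivative_works has_real_derivative_iff_has_vector_derivative)
    \<comment> \<open>By \<open>scale\<close>, \<open>q\<close> maps \<open>I\<close> into itself,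
      so the derivative of \<open>P\<close> restricts to the image and the chain rule
      applies.\<close>
    have "(P has_field_derivative D) (at (q * 0) within (*) q ` I)"
      using D scale q by (auto intro!: DERIV_subset[OF D])
    then have "((\<lambda>\<tau>. P (q * \<tau>)) has_field_derivative q * D) (at 0 within I)"
      using DERIV_image_chain[of P D "(*) q" 0 I q]
      by (auto simp: o_def mult.commute intro!: derivative_eq_intros)
    then have "qsym_deriv q I (\<lambda>\<tau>. P (q * \<tau>)) 0 = q * D"
      using vector_derivative_within[OF nb]
      by (simp add: qsym_deriv_def has_real_derivative_iff_has_vector_derivative)
    moreover have "Q 0 = q * D"
    proof -
      define s where "s n = q ^ (2 * n + 1) * c" for n
      have s: "s n \<noteq> 0" "s n \<in> I" for n
        using q \<open>c \<noteq> 0\<close> cd ab scale[of c "q ^ (2 * n + 1)"]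
        by (auto simp: s_def power_le_one simp del: power_Suc)
      have "(\<lambda>n. q ^ (2 * n + 1)) \<longlonglongrightarrow> 0"
        using q by (intro LIMSEQ_realpow_zero[THEN filterlim_compose] filterlim_subseq) (auto simp: strict_mono_def)
      then have s0: "s \<longlonglongrightarrow> 0"
        unfolding s_def by (rule tendsto_mult_left_zero)
      have lim: "filterlim s (at 0 within I) sequentially"
        using s0 s by (simp add: filterlim_at)
      have lim2: "filterlim (\<lambda>n. q\<^sup>2 * s n) (at 0 within I) sequentially"
        using tendsto_mult_right_zero[OF s0, of "q\<^sup>2"] s q scale[of _ "q\<^sup>2"]
        by (simp add: filterlim_at power_le_one)
      have quot: "((\<lambda>x. (P x - P 0) / x) \<longlongrightarrow> D) (at 0 within I)"
        using D by (simp add: has_field_derivative_iff)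
      \<comment> \<open>Inserting \<open>P 0\<close> splits the difference of \<open>P\<close>
        between \<open>s n\<close> and \<open>q\<^sup>2 * s n\<close> into two difference quotients
        at 0, each tending to \<open>D\<close>. By \<open>EL\<close> the expression equals
        \<open>Q (s n)\<close>, which tends to \<open>Q 0\<close> by continuity.\<close>
      have "(\<lambda>n. q / (1 - q\<^sup>2) * ((P (s n) - P 0) / s n - q\<^sup>2 * ((P (q\<^sup>2 * s n) - P 0) / (q\<^sup>2 * s n))))
          \<longlonglongrightarrow> q / (1 - q\<^sup>2) * (D - q\<^sup>2 * D)"
        by (intro tendsto_intros filterlim_compose[OF quot] lim lim2)
      moreover have "q / (1 - q\<^sup>2) * ((P (s n) - P 0) / s n - q\<^sup>2 * ((P (q\<^sup>2 * s n) - P 0) / (q\<^sup>2 * s n))) = Q (s n)"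
        (is "?l = _") for n
      proof -
        have "1 - q\<^sup>2 \<noteq> 0"
          using q power_less_one_iff[of q 2] by auto
        have "q ^ (2 * n + 3) * c = q\<^sup>2 * s n" "q ^ (2 * n) * c = s n / q"
          using q(1) by (simp_all add: s_def power_add power2_eq_square power3_eq_cube)
        then have "Q (s n) * ((1 - q\<^sup>2) * (s n / q)) = P (s n) - P (q\<^sup>2 * s n)"
          using EL[OF cd \<open>c \<noteq> 0\<close>, of n] unfolding s_def by metis
        then have "q / (1 - q\<^sup>2) * ((P (s n) - P (q\<^sup>2 * s n)) / s n) =
            q / (1 - q\<^sup>2) * (Q (s n) * ((1 - q\<^sup>2) * (s n / q)) / s n)"
          by simp
        also have "\<dots> = Q (s n)"
          using \<open>1 - q\<^sup>2 \<noteq> 0\<close> s(1)[of n] q(1) by simp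
        finally have "q / (1 - q\<^sup>2) * ((P (s n) - P (q\<^sup>2 * s n)) / s n) = Q (s n)" .
        moreover have "(P (s n) - P 0) / s n - q\<^sup>2 * ((P (q\<^sup>2 * s n) - P 0) / (q\<^sup>2 * s n)) =
            (P (s n) - P (q\<^sup>2 * s n)) / s n"
          using q(1) by (simp add: diff_divide_distrib[symmetric])
        ultimately show ?thesis
          by (simp only:)
      qed
      ultimately have "(\<lambda>n. Q (s n)) \<longlonglongrightarrow> q / (1 - q\<^sup>2) * (D - q\<^sup>2 * D)"
        by simp
      moreover have "(\<lambda>n. Q (s n)) \<longlonglongrightarrow> Q 0"
        using Q0 lim unfolding continuous_within by (rule filterlim_compose)
      ultimately have "Q 0 = q / (1 - q\<^sup>2) * (D - q\<^sup>2 * D)"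
        by (rule LIMSEQ_unique[rotated])
      also have "\<dots> = q / (1 - q\<^sup>2) * (1 - q\<^sup>2) * D"
        by (simp add: algebra_simps)
      also have "\<dots> = q * D"
        using q power_less_one_iff[of q 2] by simp
      finally show ?thesis .
    qed
    ultimately show ?thesis
      by simp
  qed

  fix t
  assume "t \<in> qset q a b"
  \<comment> \<open>If an endpoint is 0, its whole lattice collapses to the case
    \<open>t = 0\<close>.\<close>
  then consider "t = 0" | n where "t = q ^ (2 * n + 1) * a" "a \<noteq> 0" | n where "t = q ^ (2 * n + 1) * b" "b \<noteq> 0"
    unfolding qset_def by fastforce
  then have "Q t = qsym_deriv q I (\<lambda>\<tau>. P (q * \<tau>)) t"
    by cases (use EL_0 EL_lattice in blast)+
  then show "partial2 L t (ys (q * t)) (qsym_deriv q I ys t) =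
      qsym_deriv q I (\<lambda>\<tau>. partial3 L (q * \<tau>) (ys (q\<^sup>2 * \<tau>)) (qsym_deriv q I ys (q * \<tau>))) t"
    by (simp only: RHS Q_def)
qed

end
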